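(* Let $X=\mathbb{R}^{\mathbb{R}_+}$ be the set of all functions from $[0,\infty[$ to $\mathbb{R}$, and let $\mathcal{C}([0,\infty[,\mathbb{R})\subset X$ be the subset of continuous functions. (a) $\mathcal{C}([0,\infty[,\mathbb{R})$ is closed in $X$ equipped with the sticking topology. (b) On $\mathcal{C}([0,\infty[,\mathbb{R})$ the topology induced by the sticking topology coincides with the topology induced by point-wise convergence.
   Context: $\mathbb{R}_+=[0,\infty[$ has its usual topology. For $f\in X$, $\varepsilon>0$ and $t_1,\dots,t_k\in\mathbb{R}_+$, the elementary neighbourhood is $$E^\varepsilon_{t_1,\ldots,t_k}(f)=\{g\in X : \exists \eta>0,\ \forall t\in\mathbb{R}_+\cap\bigcup_{i=1}^k]t_i-\eta,t_i+\eta[,\ |f(t)-g(t)|<\varepsilon\}.$$ A subset $U\subset X$ is open for the sticking topology iff for each $f\in U$ it contains some elementary neighbourhood $E^\varepsilon_{t_1,\ldots,t_k}(f)$ of $f$. *)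

theory Defs
  imports "HOL-Analysis.Analysis"
begin

text \<open>
  The set of all functions from $[0,\infty[$ to the reals is represented by the functions on
  \<^typ>\<open>real\<close> that are \<^const>\<open>undefined\<close> outside \<^term>\<open>{0::real..}\<close>. This is a
  one-to-one representation, and it is the underlying set of the library's product topology
  over the index set \<^term>\<open>{0::real..}\<close>, i.e. of the topology of pointwise convergence.
\<close>

definition half_line_funs :: "(real \<Rightarrow> real) set" where
  "half_line_funs = {0..} \<rightarrow>\<^sub>E UNIV"

definition half_line_cont_funs :: "(real \<Rightarrow> real) set" where
  "half_line_cont_funs = {f \<in> half_line_funs. continuous_on {0..} f}"

definition pointwise_topology :: "(real \<Rightarrow> real) topology" where
  "pointwise_topology = product_topology (\<lambda>_. euclideanreal) {0..}"

text \<open>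
  The points $t_1, \dots, t_k$ enter an elementary neighbourhood only through the set \<open>T\<close>
  that they form.
\<close>

definition elementary_nbhd :: "real \<Rightarrow> real set \<Rightarrow> (real \<Rightarrow> real) \<Rightarrow> (real \<Rightarrow> real) set" where
  "elementary_nbhd \<epsilon> T f =
     {g \<in> half_line_funs.
        \<exists>\<eta>>0. \<forall>t \<in> {0..} \<inter> (\<Union>s\<in>T. {s - \<eta><..<s + \<eta>}). \<bar>f t - g t\<bar> < \<epsilon>}"

definition sticking_open :: "(real \<Rightarrow> real) set \<Rightarrow> bool" where
  "sticking_open U \<longleftrightarrow>
     U \<subseteq> half_line_funs \<and>
     (\<forall>f\<in>U. \<exists>\<epsilon>>0. \<exists>T. finite T \<and> T \<noteq> {} \<and> T \<subseteq> {0..} \<and> elementary_nbhd \<epsilon> T f \<subseteq> U)"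

definition sticking_topology :: "(real \<Rightarrow> real) topology" where
  "sticking_topology = topology sticking_open"

lemma elementary_nbhd_mono:
  assumes "\<epsilon> \<le> \<epsilon>'" "T' \<subseteq> T"
  shows "elementary_nbhd \<epsilon> T f \<subseteq> elementary_nbhd \<epsilon>' T' f"
proof
  fix g assume "g \<in> elementary_nbhd \<epsilon> T f"
  then obtain \<eta> where g: "g \<in> half_line_funs" and "\<eta> > 0"
    and *: "\<And>t. t \<in> {0..} \<inter> (\<Union>s\<in>T. {s - \<eta><..<s + \<eta>}) \<Longrightarrow> \<bar>f t - g t\<bar> < \<epsilon>"
    unfolding elementary_nbhd_def mem_Collect_eq by metis
  have "\<bar>f t - g t\<bar> < \<epsilon>'" if "t \<in> {0..} \<inter> (\<Union>s\<in>T'. {s - \<eta><..<s + \<eta>})" for t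
  proof -
    have "t \<in> {0..} \<inter> (\<Union>s\<in>T. {s - \<eta><..<s + \<eta>})"
      using that assms(2) by blast
    then show ?thesis
      using * assms(1) by (meson less_le_trans)
  qed
  then show "g \<in> elementary_nbhd \<epsilon>' T' f"
    unfolding elementary_nbhd_def mem_Collect_eq
    by (intro conjI exI[of _ \<eta>] ballI) (rule g, rule \<open>\<eta> > 0\<close>, assumption)
qed

lemma istopology_sticking_open: "istopology sticking_open"
  unfolding istopology_def
proof (intro conjI allI impI)
  fix U V assume U: "sticking_open U" and V: "sticking_open V"
  show "sticking_open (U \<inter> V)"
    unfolding sticking_open_def
  proof (intro conjI ballI)
    show "U \<inter> V \<subseteq> half_line_funs"
      using U by (auto simp: sticking_open_def)
    fix f assume f: "f \<in> U \<inter> V"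
    obtain \<epsilon>1 T1 where 1: "\<epsilon>1 > 0" "finite T1" "T1 \<noteq> {}" "T1 \<subseteq> {0..}" "elementary_nbhd \<epsilon>1 T1 f \<subseteq> U"
      using U f unfolding sticking_open_def by blast
    obtain \<epsilon>2 T2 where 2: "\<epsilon>2 > 0" "finite T2" "T2 \<noteq> {}" "T2 \<subseteq> {0..}" "elementary_nbhd \<epsilon>2 T2 f \<subseteq> V"
      using V f unfolding sticking_open_def by blast
    let ?\<epsilon> = "min \<epsilon>1 \<epsilon>2" and ?T = "T1 \<union> T2"
    have "elementary_nbhd ?\<epsilon> ?T f \<subseteq> U"
      by (rule subset_trans[OF elementary_nbhd_mono 1(5)]) simp_all
    moreover have "elementary_nbhd ?\<epsilon> ?T f \<subseteq> V"
      by (rule subset_trans[OF elementary_nbhd_mono 2(5)]) simp_all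
    ultimately have "elementary_nbhd ?\<epsilon> ?T f \<subseteq> U \<inter> V"
      by (rule Int_greatest)
    moreover have "?\<epsilon> > 0" "finite ?T" "?T \<noteq> {}" "?T \<subseteq> {0..}"
      using 1(1-4) 2(1-4) by simp_all
    ultimately show "\<exists>\<epsilon>>0. \<exists>T. finite T \<and> T \<noteq> {} \<and> T \<subseteq> {0..} \<and> elementary_nbhd \<epsilon> T f \<subseteq> U \<inter> V"
      by metis
  qed
next
  fix \<K> assume K: "\<forall>K\<in>\<K>. sticking_open K"
  show "sticking_open (\<Union>\<K>)"
    unfolding sticking_open_def
  proof (intro conjI ballI)
    show "\<Union>\<K> \<subseteq> half_line_funs"
      using K by (auto simp: sticking_open_def)
    fix f assume "f \<in> \<Union>\<K>"
    then obtain U where "U \<in> \<K>" "f \<in> U" by blast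
    with K have "sticking_open U" by blast
    with \<open>f \<in> U\<close> obtain \<epsilon> T where "\<epsilon> > 0" "finite T" "T \<noteq> {}" "T \<subseteq> {0..}" "elementary_nbhd \<epsilon> T f \<subseteq> U"
      unfolding sticking_open_def by blast
    moreover have "U \<subseteq> \<Union>\<K>"
      using \<open>U \<in> \<K>\<close> by (rule Union_upper)
    ultimately show "\<exists>\<epsilon>>0. \<exists>T. finite T \<and> T \<noteq> {} \<and> T \<subseteq> {0..} \<and> elementary_nbhd \<epsilon> T f \<subseteq> \<Union>\<K>"
      by (meson subset_trans)
  qed
qed

lemma openin_sticking_topology: "openin sticking_topology U \<longleftrightarrow> sticking_open U"
  unfolding sticking_topology_def using istopology_sticking_open by simp

lemma topspace_sticking_topology: "topspace sticking_topology = half_line_funs"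
proof
  show "topspace sticking_topology \<subseteq> half_line_funs"
    unfolding topspace_def openin_sticking_topology sticking_open_def by blast
  have "\<exists>\<epsilon>>0. \<exists>T. finite T \<and> T \<noteq> {} \<and> T \<subseteq> {0..} \<and> elementary_nbhd \<epsilon> T f \<subseteq> half_line_funs" for f
    by (intro exI[of _ "1::real"] exI[of _ "{0::real}"] conjI) (simp_all add: elementary_nbhd_def)
  then have "sticking_open half_line_funs"
    by (simp add: sticking_open_def)
  then show "half_line_funs \<subseteq> topspace sticking_topology"
    by (metis openin_sticking_topology openin_subset)
qed

lemma topspace_pointwise_topology: "topspace pointwise_topology = half_line_funs"
  by (simp add: pointwise_topology_def half_line_funs_def)

end

theory Submission
  imports Defs
begin

text \<open>
  A function that is uniformly close to \<open>f\<close> near \<open>s\<close> inherits a jump of \<open>f\<close> at \<open>s\<close>, so the set of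
  discontinuous functions is sticking-open. If \<open>f\<close> and \<open>g\<close> are both continuous, then
  \<open>\<bar>f - g\<bar> < \<epsilon>\<close> at finitely many points already holds on some \<open>\<eta>\<close>-neighbourhood of these points, so
  elementary neighbourhoods and pointwise cylinders have the same trace on the continuous functions.
\<close>

text \<open>It takes the same parameters as \<open>elementary_nbhd\<close>, so that the two families
  can be compared with equal \<open>\<epsilon>\<close> and \<open>T\<close>.\<close>

definition cylinder :: "real \<Rightarrow> real set \<Rightarrow> (real \<Rightarrow> real) \<Rightarrow> (real \<Rightarrow> real) set" where
  "cylinder \<epsilon> T f = {g \<in> half_line_funs. \<forall>t\<in>T. \<bar>f t - g t\<bar> < \<epsilon>}"

lemma openin_cylinder:
  assumes "finite T" "T \<subseteq> {0..}"
  shows "openin pointwise_topology (cylinder \<epsilon> T f)"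
proof -
  \<comment> \<open>Only the finitely many coordinates in \<open>T\<close> are constrained, as a
    basic open set of the product topology demands.\<close>
  let ?B = "\<lambda>t. if t \<in> T then ball (f t) \<epsilon> else UNIV"
  have "cylinder \<epsilon> T f = PiE {0..} ?B"
    using assms(2) unfolding cylinder_def half_line_funs_def PiE_def Pi_def
    by (force simp: dist_real_def)
  moreover have "openin pointwise_topology (PiE {0..} ?B)"
    unfolding pointwise_topology_def
    by (rule product_topology_basis)
       (auto intro: finite_subset[OF _ assms(1)])
  ultimately show ?thesis by simp
qed

text \<open>Since \<open>\<eta> > 0\<close>, each point of \<open>T\<close> lies in the interval
  around itself.\<close>

lemma elementary_nbhd_subset_cylinder:
  assumes "T \<subseteq> {0..}"
  shows "elementary_nbhd \<epsilon> T f \<subseteq> cylinder \<epsilon> T f"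
  using assms unfolding elementary_nbhd_def cylinder_def by fastforce

lemma pointwise_open_contains_cylinder:
  assumes "openin pointwise_topology U" "f \<in> U"
  obtains \<epsilon> T where "\<epsilon> > 0" "finite T" "T \<noteq> {}" "T \<subseteq> {0..}" "cylinder \<epsilon> T f \<subseteq> U"
proof -
  obtain B where fB: "f \<in> PiE {0..} B" and opB: "\<And>i. open (B i)"
    and fin: "finite {i. B i \<noteq> UNIV}" and BU: "PiE {0..} B \<subseteq> U"
    using product_topology_open_contains_basis[OF assms[unfolded pointwise_topology_def]] by auto
  \<comment> \<open>Inserting 0 makes \<open>T\<close> nonempty, as \<open>sticking_open\<close>
    requires. The intersection discards constraints of \<open>B\<close> at indices outside the
    half-line.\<close>
  define T where "T = insert 0 ({0..} \<inter> {i. B i \<noteq> UNIV})"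
  have T: "finite T" "T \<noteq> {}" "T \<subseteq> {0..}"
    using fin by (auto simp: T_def)
  have "\<exists>e>0. ball (f t) e \<subseteq> B t" if "t \<in> T" for t
    using that T(3) fB opB by (meson PiE_mem openE subsetD)
  then obtain e where e: "\<And>t. t \<in> T \<Longrightarrow> e t > 0 \<and> ball (f t) (e t) \<subseteq> B t"
    by metis
  define \<epsilon> where "\<epsilon> = Min (e ` T)"
  have "\<epsilon> > 0"
    using T(1,2) e by (simp add: \<epsilon>_def)
  moreover have "cylinder \<epsilon> T f \<subseteq> PiE {0..} B"
  proof
    fix g assume g: "g \<in> cylinder \<epsilon> T f"
    have "g t \<in> B t" if "t \<in> {0..}" for t
    proof (cases "t \<in> T")
      case True
      then have "\<epsilon> \<le> e t" using T(1) by (simp add: \<epsilon>_def)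
      then have "g t \<in> ball (f t) (e t)"
        using g True by (force simp: cylinder_def dist_real_def)
      then show ?thesis using e[OF True] by blast
    next
      case False
      then show ?thesis using that by (auto simp: T_def)
    qed
    then show "g \<in> PiE {0..} B"
      using g by (auto simp: cylinder_def half_line_funs_def PiE_def)
  qed
  ultimately show thesis
    using that T BU by blast
qed

text \<open>Every cylinder contains the elementary neighbourhood with the same parameters, so the
  sticking topology is finer on all of \<open>half_line_funs\<close>.\<close>

lemma sticking_open_if_pointwise_open:
  assumes "openin pointwise_topology U"
  shows "openin sticking_topology U"
  unfolding openin_sticking_topology sticking_open_def
proof (intro conjI ballI)
  show "U \<subseteq> half_line_funs"
    using openin_subset[OF assms] by (simp add: topspace_pointwise_topology)
  fix f assume "f \<in> U"
  then show "\<exists>\<epsilon>>0. \<exists>T. finite T \<and> T \<noteq> {} \<and> T \<subseteq> {0..} \<and> elementary_nbhd \<epsilon> T f \<subseteq> U"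
    using pointwise_open_contains_cylinder[OF assms] elementary_nbhd_subset_cylinder
    by (metis subset_trans)
qed

lemma continuous_cylinder_subset_elementary_nbhd:
  assumes "f \<in> half_line_cont_funs" "finite T" "T \<noteq> {}" "T \<subseteq> {0..}"
  shows "cylinder \<epsilon> T f \<inter> half_line_cont_funs \<subseteq> elementary_nbhd \<epsilon> T f"
proof
  fix g assume g: "g \<in> cylinder \<epsilon> T f \<inter> half_line_cont_funs"
  have cont: "continuous_on {0..} (\<lambda>t. \<bar>f t - g t\<bar>)"
    using assms(1) g by (intro continuous_intros) (auto simp: half_line_cont_funs_def)
  have "\<exists>d>0. \<forall>t\<in>{0..}. \<bar>t - s\<bar> < d \<longrightarrow> \<bar>f t - g t\<bar> < \<epsilon>" if "s \<in> T" for s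
  proof -
    have "s \<in> {0..}" using that assms(4) by blast
    then have "((\<lambda>t. \<bar>f t - g t\<bar>) \<longlongrightarrow> \<bar>f s - g s\<bar>) (at s within {0..})"
      using cont by (simp add: continuous_on)
    moreover have less: "\<bar>f s - g s\<bar> < \<epsilon>"
      using g that by (simp add: cylinder_def)
    ultimately have "\<forall>\<^sub>F t in at s within {0..}. \<bar>f t - g t\<bar> < \<epsilon>"
      by (rule order_tendstoD)
    \<comment> \<open>The filter \<open>at s within {0..}\<close> leaves out \<open>s\<close>
      itself; \<open>less\<close> supplies the case \<open>t = s\<close>.\<close>
    then show ?thesis
      using less unfolding eventually_at dist_real_def by metis
  qed
  then obtain d where d: "\<And>s. s \<in> T \<Longrightarrow> d s > 0"
    "\<And>s t. s \<in> T \<Longrightarrow> t \<in> {0..} \<Longrightarrow> \<bar>t - s\<bar> < d s \<Longrightarrow> \<bar>f t - g t\<bar> < \<epsilon>"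
    by metis
  \<comment> \<open>The smallest of the finitely many radii works around all points of
    \<open>T\<close> at once.\<close>
  define \<eta> where "\<eta> = Min (d ` T)"
  have "\<eta> > 0" using assms(2,3) d(1) by (simp add: \<eta>_def)
  moreover have "\<bar>f t - g t\<bar> < \<epsilon>" if t: "t \<in> {0..}" and s: "s \<in> T" "t \<in> {s - \<eta><..<s + \<eta>}" for s t
  proof (rule d(2)[OF s(1) t])
    have "\<eta> \<le> d s" using assms(2) s(1) by (simp add: \<eta>_def)
    then show "\<bar>t - s\<bar> < d s" using s(2) by auto
  qed
  moreover have "g \<in> half_line_funs" using g by (simp add: cylinder_def)
  ultimately show "g \<in> elementary_nbhd \<epsilon> T f"
    unfolding elementary_nbhd_def by blast
qed

text \<open>Around each continuous \<open>f\<close> in \<open>U\<close>, the trace of a cylinder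
  fits into an elementary neighbourhood of \<open>f\<close> inside \<open>U\<close>.\<close>

lemma sticking_open_trace_pointwise_open:
  assumes "openin sticking_topology U"
  shows "openin (subtopology pointwise_topology half_line_cont_funs) (U \<inter> half_line_cont_funs)"
proof (subst openin_subopen, intro ballI)
  fix f assume f: "f \<in> U \<inter> half_line_cont_funs"
  obtain \<epsilon> T where "\<epsilon> > 0" and T: "finite T" "T \<noteq> {}" "T \<subseteq> {0..}" and nb: "elementary_nbhd \<epsilon> T f \<subseteq> U"
    using assms f unfolding openin_sticking_topology sticking_open_def by blast
  let ?V = "cylinder \<epsilon> T f \<inter> half_line_cont_funs"
  have "openin (subtopology pointwise_topology half_line_cont_funs) ?V"
    using openin_cylinder[OF T(1,3)] by (auto simp: openin_subtopology)
  moreover have "f \<in> ?V"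
    using f \<open>\<epsilon> > 0\<close> by (auto simp: cylinder_def half_line_cont_funs_def)
  moreover have "?V \<subseteq> U \<inter> half_line_cont_funs"
    using continuous_cylinder_subset_elementary_nbhd[of f T \<epsilon>] f T nb by blast
  ultimately show "\<exists>V. openin (subtopology pointwise_topology half_line_cont_funs) V \<and> f \<in> V
      \<and> V \<subseteq> U \<inter> half_line_cont_funs"
    by blast
qed

text \<open>If \<open>g\<close> were continuous at \<open>s\<close>, then for some \<open>t\<close>
  near \<open>s\<close> with a jump of at least \<open>e\<close>, the three terms of \<open>\<bar>f
  t - f s\<bar> \<le> \<bar>f t - g t\<bar> + \<bar>g t - g s\<bar> + \<bar>g s - f s\<bar>\<close>
  would each be below \<open>e/3\<close>.\<close>

lemma elementary_nbhd_of_jump: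
  assumes "s \<in> {0..}" "e > 0"
    and jump: "\<And>d. d > 0 \<Longrightarrow> \<exists>t\<in>{0..}. \<bar>t - s\<bar> < d \<and> \<bar>f t - f s\<bar> \<ge> e"
    and g: "g \<in> elementary_nbhd (e/3) {s} f"
  shows "\<not> continuous_on {0..} g"
proof
  assume "continuous_on {0..} g"
  moreover have "e/3 > 0" using assms(2) by simp
  ultimately obtain d where d: "d > 0" "\<And>t. t \<in> {0..} \<Longrightarrow> \<bar>t - s\<bar> < d \<Longrightarrow> \<bar>g t - g s\<bar> < e/3"
    using assms(1) unfolding continuous_on_iff dist_real_def by metis
  obtain \<eta> where \<eta>: "\<eta> > 0" "\<And>t. t \<in> {0..} \<Longrightarrow> t \<in> {s - \<eta><..<s + \<eta>} \<Longrightarrow> \<bar>f t - g t\<bar> < e/3"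
    using g unfolding elementary_nbhd_def by auto
  \<comment> \<open>The point \<open>t\<close> must lie within \<open>d\<close> of \<open>s\<close>
    for the continuity of \<open>g\<close> and within \<open>\<eta>\<close> for the closeness of
    \<open>f\<close> and \<open>g\<close>.\<close>
  obtain t where t: "t \<in> {0..}" "\<bar>t - s\<bar> < min d \<eta>" "\<bar>f t - f s\<bar> \<ge> e"
    using jump[of "min d \<eta>"] d(1) \<eta>(1) by auto
  have "t \<in> {s - \<eta><..<s + \<eta>}" "s \<in> {s - \<eta><..<s + \<eta>}"
    using t(2) \<eta>(1) by auto
  then have "\<bar>f t - g t\<bar> < e/3" "\<bar>f s - g s\<bar> < e/3"
    using \<eta>(2) t(1) assms(1) by blast+
  moreover have "\<bar>g t - g s\<bar> < e/3"
    using d(2) t(1,2) by simp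
  ultimately show False using t(3) by linarith
qed

lemma closedin_half_line_cont_funs: "closedin sticking_topology half_line_cont_funs"
  unfolding closedin_def topspace_sticking_topology openin_sticking_topology sticking_open_def
proof (intro conjI ballI)
  show "half_line_cont_funs \<subseteq> half_line_funs" "half_line_funs - half_line_cont_funs \<subseteq> half_line_funs"
    by (auto simp: half_line_cont_funs_def)
  fix f assume "f \<in> half_line_funs - half_line_cont_funs"
  then have "\<not> continuous_on {0..} f" by (simp add: half_line_cont_funs_def)
  then obtain s e where s: "s \<in> {0..}" "e > 0"
    and jump: "\<And>d. d > 0 \<Longrightarrow> \<exists>t\<in>{0..}. \<bar>t - s\<bar> < d \<and> \<bar>f t - f s\<bar> \<ge> e"
    unfolding continuous_on_iff dist_real_def by (metis not_less)
  have "elementary_nbhd (e/3) {s} f \<subseteq> half_line_funs - half_line_cont_funs"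
    using elementary_nbhd_of_jump[OF s jump]
    by (auto simp: half_line_cont_funs_def elementary_nbhd_def)
  then show "\<exists>\<epsilon>>0. \<exists>T. finite T \<and> T \<noteq> {} \<and> T \<subseteq> {0..}
      \<and> elementary_nbhd \<epsilon> T f \<subseteq> half_line_funs - half_line_cont_funs"
    using s by (intro exI[of _ "e/3"] conjI exI[of _ "{s}"]) auto
qed

theorem proposition2:
  "closedin sticking_topology half_line_cont_funs \<and>
   subtopology sticking_topology half_line_cont_funs =
     subtopology pointwise_topology half_line_cont_funs"
proof (intro conjI closedin_half_line_cont_funs)
  show "subtopology sticking_topology half_line_cont_funs =
     subtopology pointwise_topology half_line_cont_funs"
    unfolding topology_eq
  proof (intro allI iffI)
    fix S
    assume "openin (subtopology sticking_topology half_line_cont_funs) S"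
    \<comment> \<open>The unfolding is restricted to \<open>sticking_topology\<close>, so that the
      goal keeps the form in which the trace lemma delivers it.\<close>
    then show "openin (subtopology pointwise_topology half_line_cont_funs) S"
      using sticking_open_trace_pointwise_open by (auto simp: openin_subtopology[of sticking_topology])
  next
    fix S
    assume "openin (subtopology pointwise_topology half_line_cont_funs) S"
    then show "openin (subtopology sticking_topology half_line_cont_funs) S"
      using sticking_open_if_pointwise_open by (auto simp: openin_subtopology)
  qed
qed

end
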